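(* Let $\sigma>0$, let $X$ be a reflexive Banach space, let $K\subset X$ be nonempty, closed, and convex, and let $f\colon K\to\mathbb{R}$ be lower semicontinuous and $\sigma$-strongly quasiconvex. Then there exists $\overline{x}\in K$ such that $\operatorname{argmin}_K(f)=\{\overline{x}\}$. Furthermore, for any $y\in K$ we have $$f(\overline{x})+\frac{\sigma}{4}\|y-\overline{x}\|^2\le f(y).$$
   Context: All normed vector spaces are real and nontrivial. For $\sigma>0$, $f\colon K\to\mathbb{R}$ is $\sigma$-strongly quasiconvex if $f(\lambda x+(1-\lambda)y)\le\max\{f(x),f(y)\}-\frac{\sigma}{2}\lambda(1-\lambda)\|x-y\|^2$ for all $x,y\in K$ and $0<\lambda<1$. $\operatorname{argmin}_K(f)$ denotes the set of points of $K$ at which $f$ attains its minimum over $K$. *)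

theory Defs
  imports "HOL-Analysis.Analysis"
begin

text \<open>
  The canonical embedding of a normed space into its bidual, sending \<open>x\<close> to evaluation at \<open>x\<close>.
\<close>

definition bidual_embedding ::
    "'a::real_normed_vector \<Rightarrow> (('a \<Rightarrow>\<^sub>L real) \<Rightarrow>\<^sub>L real)"
  where "bidual_embedding x = blinfun.prod_left x"

lemma bidual_embedding_apply [simp]:
  "blinfun_apply (bidual_embedding x) \<phi> = blinfun_apply \<phi> x"
  by (simp add: bidual_embedding_def blinfun.prod_left.rep_eq)

definition reflexive_space :: "'a::real_normed_vector itself \<Rightarrow> bool"
  where "reflexive_space _ \<longleftrightarrow>
    surj (bidual_embedding :: 'a \<Rightarrow> (('a \<Rightarrow>\<^sub>L real) \<Rightarrow>\<^sub>L real))"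

text \<open>
  A function \<open>K \<rightarrow> \<real>\<close> is represented by a function on the whole type; the notions below only
  look at its values on \<open>K\<close>. In particular semicontinuity is with respect to the subspace
  topology of \<open>K\<close>.
\<close>

definition lower_semicontinuous_on ::
    "'a::topological_space set \<Rightarrow> ('a \<Rightarrow> real) \<Rightarrow> bool"
  where "lower_semicontinuous_on K f \<longleftrightarrow>
    (\<forall>x\<in>K. \<forall>c. c < f x \<longrightarrow> (\<forall>\<^sub>F y in at x within K. c < f y))"

definition strongly_quasiconvex_on ::
    "real \<Rightarrow> 'a::real_normed_vector set \<Rightarrow> ('a \<Rightarrow> real) \<Rightarrow> bool"
  where "strongly_quasiconvex_on \<sigma> K f \<longleftrightarrow>
    (\<forall>x\<in>K. \<forall>y\<in>K. \<forall>t::real. 0 < t \<and> t < 1 \<longrightarrow>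
      f (t *\<^sub>R x + (1 - t) *\<^sub>R y)
        \<le> max (f x) (f y) - \<sigma> / 2 * t * (1 - t) * (norm (x - y))\<^sup>2)"

definition argmin_on :: "'a set \<Rightarrow> ('a \<Rightarrow> real) \<Rightarrow> 'a set"
  where "argmin_on K f = {x. is_arg_min f (\<lambda>z. z \<in> K) x}"

end

theory Submission
  imports Defs
begin

text \<open>
  In a reflexive space a directed family of nonempty closed convex bounded sets has nonempty
  intersection, so a quasiconvex lower semicontinuous function attains its minimum on every nonempty
  closed convex bounded set. Strong quasiconvexity extends this to unbounded \<open>K\<close>: if
  \<open>f y \<le> f x\<^sub>0\<close>, then on the segment from \<open>x\<^sub>0\<close> to \<open>y\<close> the point at distance \<open>1\<close> from \<open>x\<^sub>0\<close> has
  value at most \<open>f x\<^sub>0 - \<sigma>/2 (\<parallel>y - x\<^sub>0\<parallel> - 1)\<close>, and a lower bound for \<open>f\<close> on the unit ball around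
  \<open>x\<^sub>0\<close> then bounds the sublevel set of \<open>x\<^sub>0\<close>.
  For the growth estimate, the best constant \<open>c\<close> in \<open>f x + c \<parallel>y - x\<parallel>\<^sup>2 \<le> f y\<close> satisfies
  \<open>c \<ge> c (1 - t)\<^sup>2 + \<sigma>/2 t (1 - t)\<close> for all \<open>t\<close> in \<open>(0, 1)\<close>; letting \<open>t\<close> tend to \<open>0\<close>
  gives \<open>c \<ge> \<sigma>/4\<close>.
\<close>

section \<open>Sublinear functionals and the Hahn-Banach theorem\<close>

definition sublinear :: "('a::real_vector \<Rightarrow> real) \<Rightarrow> bool"
  where "sublinear p \<longleftrightarrow>
    (\<forall>x y. p (x + y) \<le> p x + p y) \<and> (\<forall>c>0. \<forall>x. p (c *\<^sub>R x) \<le> c * p x)"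

lemma sublinear_add: "sublinear p \<Longrightarrow> p (x + y) \<le> p x + p y"
  and sublinear_scale_le: "sublinear p \<Longrightarrow> c > 0 \<Longrightarrow> p (c *\<^sub>R x) \<le> c * p x"
  by (auto simp: sublinear_def)

lemma sublinear_zero:
  assumes "sublinear p"
  shows "p 0 = 0"
  using sublinear_add[OF assms, of 0 0] sublinear_scale_le[OF assms, of "1/2" 0] by simp

text \<open>The reverse inequality is the defining one for the factor \<open>1 / c\<close>, applied
  at the scaled vector. Hence a candidate such as an infimum only has to be checked in one
  direction.\<close>

lemma sublinear_scale:
  assumes "sublinear p" "c \<ge> 0"
  shows "p (c *\<^sub>R x) = c * p x"
proof (cases "c = 0")
  case True
  then show ?thesis by (simp add: sublinear_zero[OF assms(1)])
next
  case False
  then have c: "c > 0" using assms by simp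
  have "p x \<le> (1/c) * p (c *\<^sub>R x)"
    using sublinear_scale_le[OF assms(1), of "1/c" "c *\<^sub>R x"] c by simp
  then have "c * p x \<le> p (c *\<^sub>R x)" using c by (simp add: field_simps)
  then show ?thesis using sublinear_scale_le[OF assms(1) c, of x] by simp
qed

lemma sublinear_minus_ge:
  assumes "sublinear p"
  shows "- p (- x) \<le> p x"
  using sublinear_add[OF assms, of x "- x"] sublinear_zero[OF assms] by simp

text \<open>The relation \<open>Q\<close> is a convex cone in the product with \<open>\<real>\<close>, an epigraph up to closure.\<close>

lemma sublinear_Inf_cone:
  fixes Q :: "'a::real_vector \<Rightarrow> real \<Rightarrow> bool"
  assumes ne: "\<And>x. \<exists>s. Q x s"
    and bdd: "\<And>x s. Q x s \<Longrightarrow> b x \<le> s"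
    and add: "\<And>x y s t. Q x s \<Longrightarrow> Q y t \<Longrightarrow> \<exists>u\<le>s + t. Q (x + y) u"
    and scale: "\<And>x s c. Q x s \<Longrightarrow> c > 0 \<Longrightarrow> Q (c *\<^sub>R x) (c * s)"
  shows "sublinear (\<lambda>x. Inf {s. Q x s})"
    and "Q x s \<Longrightarrow> Inf {s. Q x s} \<le> s"
proof -
  have lower: "Inf {s. Q x s} \<le> s" if "Q x s" for x s
    using that bdd by (intro cInf_lower bdd_belowI[of _ "b x"]) auto
  have approx: "\<exists>s. Q x s \<and> s < Inf {s. Q x s} + e" if "e > 0" for x e
    using cInf_lessD[of "{s. Q x s}" "Inf {s. Q x s} + e"] ne[of x] that by auto
  show "sublinear (\<lambda>x. Inf {s. Q x s})"
    unfolding sublinear_def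
  proof (intro conjI allI impI)
    fix x y
    show "Inf {s. Q (x + y) s} \<le> Inf {s. Q x s} + Inf {s. Q y s}"
    proof (rule field_le_epsilon)
      fix e :: real assume e: "e > 0"
      obtain s where s: "Q x s" "s < Inf {s. Q x s} + e / 2"
        using approx[of "e / 2"] e by auto
      obtain t where t: "Q y t" "t < Inf {s. Q y s} + e / 2"
        using approx[of "e / 2"] e by auto
      obtain u where "u \<le> s + t" "Q (x + y) u" using add s(1) t(1) by blast
      then show "Inf {s. Q (x + y) s} \<le> Inf {s. Q x s} + Inf {s. Q y s} + e"
        using lower[of "x + y" u] s(2) t(2) by linarith
    qed
  next
    fix c :: real and x assume c: "c > 0"
    have "Inf {s. Q (c *\<^sub>R x) s} / c \<le> Inf {s. Q x s}"
    proof (rule cInf_greatest)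
      show "{s. Q x s} \<noteq> {}" using ne by auto
      fix s assume "s \<in> {s. Q x s}"
      then have "Inf {s. Q (c *\<^sub>R x) s} \<le> c * s" using lower scale c by blast
      then show "Inf {s. Q (c *\<^sub>R x) s} / c \<le> s" using c by (simp add: field_simps)
    qed
    then show "Inf {s. Q (c *\<^sub>R x) s} \<le> c * Inf {s. Q x s}"
      using c by (simp add: field_simps)
  qed
  show "Q x s \<Longrightarrow> Inf {s. Q x s} \<le> s" by (rule lower)
qed

text \<open>For fixed \<open>v\<close>, the infimum over \<open>t \<ge> 0\<close> of
  \<open>q (x + t *\<^sub>R v) - t * q v\<close> is sublinear in \<open>x\<close>. It lies below
  \<open>q\<close> by \<open>t = 0\<close>, and its value at \<open>- v\<close> is at most
  \<open>- q v\<close> by \<open>t = 1\<close>. Minimality identifies it with \<open>q\<close>, so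
  \<open>q\<close> is odd, and an odd sublinear functional is linear.\<close>

lemma linear_if_minimal_sublinear:
  fixes q :: "'a::real_vector \<Rightarrow> real"
  assumes q: "sublinear q"
    and minimal: "\<And>r. sublinear r \<Longrightarrow> (\<And>x. r x \<le> q x) \<Longrightarrow> r = q"
  shows "linear q"
proof -
  have uminus: "q (- v) = - q v" for v
  proof -
    define Q where "Q x s \<longleftrightarrow> (\<exists>t\<ge>0. s = q (x + t *\<^sub>R v) - t * q v)" for x s
    have Q0: "Q x (q x)" for x unfolding Q_def by (intro exI[of _ 0]) simp
    have ne: "\<exists>s. Q x s" for x using Q0 by blast
    have bdd: "- q (- x) \<le> s" if "Q x s" for x s
    proof -
      obtain t where t: "t \<ge> 0" "s = q (x + t *\<^sub>R v) - t * q v"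
        using \<open>Q x s\<close> unfolding Q_def by blast
      have "t * q v = q ((x + t *\<^sub>R v) + - x)" using sublinear_scale[OF q t(1)] by simp
      also have "\<dots> \<le> q (x + t *\<^sub>R v) + q (- x)" by (rule sublinear_add[OF q])
      finally show ?thesis using t(2) by simp
    qed
    have add: "\<exists>u\<le>s + t. Q (x + y) u" if "Q x s" "Q y t" for x y s t
    proof -
      obtain a where a: "a \<ge> 0" "s = q (x + a *\<^sub>R v) - a * q v"
        using \<open>Q x s\<close> unfolding Q_def by blast
      obtain b where b: "b \<ge> 0" "t = q (y + b *\<^sub>R v) - b * q v"
        using \<open>Q y t\<close> unfolding Q_def by blast
      have "q ((x + y) + (a + b) *\<^sub>R v) \<le> q (x + a *\<^sub>R v) + q (y + b *\<^sub>R v)"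
        using sublinear_add[OF q, of "x + a *\<^sub>R v" "y + b *\<^sub>R v"] by (simp add: algebra_simps)
      then have "q ((x + y) + (a + b) *\<^sub>R v) - (a + b) * q v \<le> s + t"
        using a b by (simp add: algebra_simps)
      moreover have "Q (x + y) (q ((x + y) + (a + b) *\<^sub>R v) - (a + b) * q v)"
        unfolding Q_def using a(1) b(1) by (intro exI[of _ "a + b"]) simp
      ultimately show ?thesis by blast
    qed
    have scale: "Q (c *\<^sub>R x) (c * s)" if "Q x s" "c > 0" for x s c
    proof -
      obtain t where t: "t \<ge> 0" "s = q (x + t *\<^sub>R v) - t * q v"
        using \<open>Q x s\<close> unfolding Q_def by blast
      have "c * s = q (c *\<^sub>R x + (c * t) *\<^sub>R v) - (c * t) * q v"
        using sublinear_scale[OF q, of c "x + t *\<^sub>R v"] \<open>c > 0\<close> t(2)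
        by (simp add: scaleR_add_right right_diff_distrib)
      then show ?thesis unfolding Q_def using t(1) \<open>c > 0\<close>
        by (intro exI[of _ "c * t"]) simp
    qed
    have r1: "sublinear (\<lambda>x. Inf {s. Q x s})"
      by (rule sublinear_Inf_cone(1)[of Q "\<lambda>x. - q (- x)"]; fact ne bdd add scale)
    have r2: "Inf {s. Q x s} \<le> s" if "Q x s" for x s
      by (rule sublinear_Inf_cone(2)[of Q "\<lambda>x. - q (- x)"]; fact ne bdd add scale that)
    have "(\<lambda>x. Inf {s. Q x s}) = q" by (intro minimal r1 r2 Q0)
    moreover have "Q (- v) (- q v)"
      unfolding Q_def using sublinear_zero[OF q] by (intro exI[of _ 1]) simp
    ultimately have "q (- v) \<le> - q v" using r2 by metis
    then show ?thesis using sublinear_minus_ge[OF q, of v] by simp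
  qed
  show ?thesis
  proof (rule linearI)
    fix x y
    have "q x \<le> q (x + y) + q (- y)" using sublinear_add[OF q, of "x + y" "- y"] by simp
    then show "q (x + y) = q x + q y" using sublinear_add[OF q, of x y] uminus[of y] by simp
  next
    fix c x
    show "q (c *\<^sub>R x) = c *\<^sub>R q x"
    proof (cases "c \<ge> 0")
      case True
      then show ?thesis using sublinear_scale[OF q] by simp
    next
      case False
      then show ?thesis
        using sublinear_scale[OF q, of "- c" x] uminus[of "c *\<^sub>R x"] by simp
    qed
  qed
qed

text \<open>Zorn's lemma yields a minimal sublinear functional below \<open>p\<close>, and minimal
  ones are linear. A nonempty chain is bounded by its pointwise infimum, which is finite because
  every member is at least \<open>- p (- x)\<close> at \<open>x\<close>.\<close>

theorem Hahn_Banach_sublinear: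
  fixes p :: "'a::real_vector \<Rightarrow> real"
  assumes p: "sublinear p"
  obtains L where "linear L" "\<And>x. L x \<le> p x"
proof -
  define A where "A = {q. sublinear q \<and> (\<forall>x. q x \<le> p x)}"
  \<comment> \<open>\<open>R\<close> points downwards: an upper bound for Zorn's lemma is a
    pointwise minorant, and a maximal element is a minimal functional.\<close>
  define R :: "('a \<Rightarrow> real) \<Rightarrow> ('a \<Rightarrow> real) \<Rightarrow> bool" where "R q r \<longleftrightarrow> (\<forall>x. r x \<le> q x)" for q r
  have "\<exists>m\<in>A. \<forall>a\<in>A. R m a \<longrightarrow> a = m"
  proof (rule predicate_Zorn)
    show "partial_order_on A (relation_of R A)"
      unfolding partial_order_on_def preorder_on_def relation_of_def refl_on_def trans_def antisym_def
      by (auto simp: R_def fun_eq_iff intro: order_trans antisym)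
  next
    fix C assume C: "C \<in> Chains (relation_of R A)"
    then have CA: "C \<subseteq> A" by (rule Chains_relation_of)
    show "\<exists>u\<in>A. \<forall>a\<in>C. R a u"
    proof (cases "C = {}")
      case True
      then show ?thesis using p by (auto simp: A_def)
    next
      case False
      define Q where "Q x s \<longleftrightarrow> (\<exists>q\<in>C. s = q x)" for x s
      have ne: "\<exists>s. Q x s" for x using False by (auto simp: Q_def)
      have bdd: "- p (- x) \<le> s" if "Q x s" for x s
      proof -
        obtain q where q: "q \<in> C" "s = q x" using \<open>Q x s\<close> by (auto simp: Q_def)
        then have "sublinear q" "q (- x) \<le> p (- x)" using CA by (auto simp: A_def)
        then show ?thesis using sublinear_minus_ge[of q x] q(2) by linarith
      qed
      have add: "\<exists>u\<le>s + t. Q (x + y) u" if "Q x s" "Q y t" for x y s t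
      proof -
        obtain q where q: "q \<in> C" "s = q x" using \<open>Q x s\<close> by (auto simp: Q_def)
        obtain r where r: "r \<in> C" "t = r y" using \<open>Q y t\<close> by (auto simp: Q_def)
        \<comment> \<open>Members of a chain are comparable, so the smaller of \<open>q\<close> and
          \<open>r\<close> serves at both points. Without this the infimum need not be
          subadditive.\<close>
        have "R q r \<or> R r q" using C q r unfolding Chains_def relation_of_def by auto
        then obtain w where w: "w \<in> C" "w x \<le> s" "w y \<le> t"
          using q r unfolding R_def by blast
        then have "sublinear w" using CA by (auto simp: A_def)
        then show ?thesis using sublinear_add[of w x y] w unfolding Q_def
          by (intro exI[of _ "w (x + y)"]) auto
      qed
      have scale: "Q (c *\<^sub>R x) (c * s)" if "Q x s" "c > 0" for x s c
      proof -
        obtain q where q: "q \<in> C" "s = q x" using \<open>Q x s\<close> by (auto simp: Q_def)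
        then have "sublinear q" using CA by (auto simp: A_def)
        then show ?thesis using sublinear_scale[of q c x] q \<open>c > 0\<close>
          unfolding Q_def by (intro bexI[of _ q]) auto
      qed
      have r1: "sublinear (\<lambda>x. Inf {s. Q x s})"
        by (rule sublinear_Inf_cone(1)[of Q "\<lambda>x. - p (- x)"]; fact ne bdd add scale)
      have r2: "Inf {s. Q x s} \<le> s" if "Q x s" for x s
        by (rule sublinear_Inf_cone(2)[of Q "\<lambda>x. - p (- x)"]; fact ne bdd add scale that)
      have le: "Inf {s. Q x s} \<le> q x" if "q \<in> C" for q x
        by (rule r2) (use that in \<open>auto simp: Q_def\<close>)
      obtain q where "q \<in> C" using False by blast
      then have "\<forall>x. Inf {s. Q x s} \<le> p x"
        using le[of q] CA by (force simp: A_def intro: order_trans)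
      then have "(\<lambda>x. Inf {s. Q x s}) \<in> A" using r1 by (simp add: A_def)
      then show ?thesis using le unfolding R_def by (intro bexI) auto
    qed
  qed
  then obtain m where m: "m \<in> A" "\<And>a. a \<in> A \<Longrightarrow> R m a \<Longrightarrow> a = m" by blast
  have "linear m"
  proof (rule linear_if_minimal_sublinear)
    show "sublinear m" using m(1) by (simp add: A_def)
    fix r assume r: "sublinear r" "\<And>x. r x \<le> m x"
    then have "r \<in> A" using m(1) unfolding A_def by (auto intro: order_trans)
    then show "r = m" using m(2) r(2) by (simp add: R_def)
  qed
  then show ?thesis using that m(1) by (auto simp: A_def)
qed

section \<open>Separation of a point from a closed convex set\<close>

lemma linear_bounded_above_imp_bounded_linear:
  fixes L :: "'a::real_normed_vector \<Rightarrow> real"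
  assumes "linear L" "\<And>x. L x \<le> M * norm x"
  shows "bounded_linear L"
proof (rule bounded_linear_intro)
  show "L (x + y) = L x + L y" for x y by (rule linear_add[OF assms(1)])
  show "L (r *\<^sub>R x) = r *\<^sub>R L x" for r x by (rule linear_scale[OF assms(1)])
  \<comment> \<open>The one-sided bound at \<open>- x\<close> is the missing lower bound at
    \<open>x\<close>.\<close>
  show "norm (L x) \<le> norm x * M" for x
    using assms(2)[of x] assms(2)[of "- x"] linear_neg[OF assms(1), of x]
    by (simp add: abs_le_iff mult.commute)
qed

text \<open>Two multiples of points of \<open>C\<close> merge into one multiple of a single point of
  \<open>C\<close>; this makes the infimum in the separation argument subadditive.\<close>

lemma convex_cone_combination:
  assumes "convex C" "c \<in> C" "d \<in> C" "s \<ge> 0" "t \<ge> 0"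
  obtains e where "e \<in> C" "s *\<^sub>R c + t *\<^sub>R d = (s + t) *\<^sub>R e"
proof (cases "s + t = 0")
  case True
  then have "s = 0" "t = 0" using assms by auto
  then show ?thesis using that[OF \<open>c \<in> C\<close>] by simp
next
  case False
  then have pos: "s + t > 0" using assms by simp
  have "(s / (s + t)) *\<^sub>R c + (t / (s + t)) *\<^sub>R d \<in> C"
    using assms pos by (intro convexD) (auto simp: add_divide_distrib[symmetric])
  then show ?thesis using that pos by (force simp: scaleR_add_right)
qed

text \<open>
  The separating functional is a linear minorant of
  \<open>y \<mapsto> inf {\<parallel>y + t (c - x)\<parallel> - t \<delta> | t \<ge> 0, c \<in> C}\<close> with \<open>\<delta>\<close> the distance from \<open>x\<close> to \<open>C\<close>.
\<close>

lemma separating_blinfun_closed_point: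
  fixes C :: "'a::real_normed_vector set"
  assumes "convex C" "closed C" "x \<notin> C"
  obtains \<phi> :: "'a \<Rightarrow>\<^sub>L real" and \<delta> where "\<delta> > 0" "\<And>c. c \<in> C \<Longrightarrow> \<phi> x + \<delta> \<le> \<phi> c"
proof (cases "C = {}")
  case True
  then show ?thesis using that[of 1 0] by simp
next
  case False
  then obtain c0 where c0: "c0 \<in> C" by blast
  define \<delta> where "\<delta> = infdist x C"
  have pos: "\<delta> > 0" using assms False infdist_pos_not_in_closed unfolding \<delta>_def by blast
  have dist: "\<delta> \<le> norm (c - x)" if "c \<in> C" for c
    using infdist_le[OF that, of x] by (simp add: \<delta>_def dist_norm norm_minus_commute)
  define Q where
    "Q y s \<longleftrightarrow> (\<exists>t\<ge>0. \<exists>c\<in>C. s = norm (y + t *\<^sub>R (c - x)) - t * \<delta>)" for y s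
  have Qn: "Q y (norm y)" for y
    unfolding Q_def using c0 by (intro exI[of _ 0]) auto
  have ne: "\<exists>s. Q y s" for y using Qn by blast
  \<comment> \<open>Since \<delta> is the distance from \<open>x\<close> to \<open>C\<close>, the
    subtracted \<open>t * \<delta>\<close> is at most the norm of
    \<open>t *\<^sub>R (c - x)\<close>, so the triangle inequality loses no more than
    \<open>norm y\<close>.\<close>
  have bdd: "- norm y \<le> s" if "Q y s" for y s
  proof -
    obtain t c where t: "t \<ge> 0" "c \<in> C" "s = norm (y + t *\<^sub>R (c - x)) - t * \<delta>"
      using \<open>Q y s\<close> unfolding Q_def by blast
    have "t * \<delta> \<le> norm (t *\<^sub>R (c - x))" using mult_left_mono[OF dist[OF t(2)] t(1)] t(1) by simp
    moreover have "norm (t *\<^sub>R (c - x)) \<le> norm (y + t *\<^sub>R (c - x)) + norm y"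
      using norm_triangle_ineq4[of "y + t *\<^sub>R (c - x)" y] by simp
    ultimately show ?thesis using t(3) by linarith
  qed
  have add: "\<exists>u\<le>s + t. Q (y + z) u" if "Q y s" "Q z t" for y z s t
  proof -
    obtain a c where a: "a \<ge> 0" "c \<in> C" "s = norm (y + a *\<^sub>R (c - x)) - a * \<delta>"
      using \<open>Q y s\<close> unfolding Q_def by blast
    obtain b d where b: "b \<ge> 0" "d \<in> C" "t = norm (z + b *\<^sub>R (d - x)) - b * \<delta>"
      using \<open>Q z t\<close> unfolding Q_def by blast
    obtain e where e: "e \<in> C" "a *\<^sub>R c + b *\<^sub>R d = (a + b) *\<^sub>R e"
      using convex_cone_combination[OF assms(1) a(2) b(2) a(1) b(1)] by blast
    have "(y + z) + (a + b) *\<^sub>R (e - x) = (y + a *\<^sub>R (c - x)) + (z + b *\<^sub>R (d - x))"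
      using e(2) by (simp add: algebra_simps)
    then have "norm ((y + z) + (a + b) *\<^sub>R (e - x))
        \<le> norm (y + a *\<^sub>R (c - x)) + norm (z + b *\<^sub>R (d - x))"
      by (simp only: norm_triangle_ineq)
    then have "norm ((y + z) + (a + b) *\<^sub>R (e - x)) - (a + b) * \<delta> \<le> s + t"
      using a b by (simp add: algebra_simps)
    moreover have "Q (y + z) (norm ((y + z) + (a + b) *\<^sub>R (e - x)) - (a + b) * \<delta>)"
      unfolding Q_def using a(1) b(1) e(1) by (intro exI[of _ "a + b"]) auto
    ultimately show ?thesis by blast
  qed
  have scale: "Q (k *\<^sub>R y) (k * s)" if "Q y s" "k > 0" for y s k
  proof -
    obtain t c where t: "t \<ge> 0" "c \<in> C" "s = norm (y + t *\<^sub>R (c - x)) - t * \<delta>"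
      using \<open>Q y s\<close> unfolding Q_def by blast
    have "norm (k *\<^sub>R y + (k * t) *\<^sub>R (c - x)) = norm (k *\<^sub>R (y + t *\<^sub>R (c - x)))"
      by (simp add: scaleR_add_right)
    also have "\<dots> = k * norm (y + t *\<^sub>R (c - x))" using \<open>k > 0\<close> by simp
    finally have "k * s = norm (k *\<^sub>R y + (k * t) *\<^sub>R (c - x)) - (k * t) * \<delta>"
      using t(3) by (simp add: right_diff_distrib)
    then show ?thesis unfolding Q_def using t \<open>k > 0\<close>
      by (intro exI[of _ "k * t"]) auto
  qed
  have r1: "sublinear (\<lambda>x. Inf {s. Q x s})"
    by (rule sublinear_Inf_cone(1)[of Q "\<lambda>y. - norm y"]; fact ne bdd add scale)
  have r2: "Inf {s. Q x s} \<le> s" if "Q x s" for x s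
    by (rule sublinear_Inf_cone(2)[of Q "\<lambda>y. - norm y"]; fact ne bdd add scale that)
  obtain L where L: "linear L" "\<And>y. L y \<le> Inf {s. Q y s}"
    using Hahn_Banach_sublinear[OF r1] by blast
  have LQ: "L y \<le> s" if "Q y s" for y s using L(2)[of y] r2[OF that] by linarith
  have "bounded_linear L"
    using linear_bounded_above_imp_bounded_linear[OF L(1), of 1] LQ[OF Qn] by simp
  then have \<phi>: "blinfun_apply (Blinfun L) = L" by (rule bounded_linear_Blinfun_apply)
  have "L x + \<delta> \<le> L c" if "c \<in> C" for c
  proof -
    \<comment> \<open>With \<open>t = 1\<close> and this \<open>c\<close> the norm vanishes and only
      \<open>- \<delta>\<close> is left.\<close>
    have "Q (x - c) (- \<delta>)" unfolding Q_def using that by (intro exI[of _ 1]) force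
    then have "L (x - c) \<le> - \<delta>" by (rule LQ)
    then show ?thesis using linear_diff[OF L(1), of x c] by simp
  qed
  then show ?thesis using that[of \<delta> "Blinfun L"] pos \<phi> by simp
qed

section \<open>Compactness in reflexive spaces\<close>

text \<open>
  A linear minorant of \<open>\<phi> \<mapsto> inf\<^sub>C sup\<^sub>x\<^sub>\<in>\<^sub>C \<phi> x\<close> on the dual is evaluation at a point by
  reflexivity, and no functional separates that point from a member of the family.
\<close>

lemma reflexive_directed_Inter_nonempty:
  fixes \<C> :: "'a::real_normed_vector set set"
  assumes refl: "reflexive_space TYPE('a)"
    and ne: "\<C> \<noteq> {}"
    and mem: "\<And>C. C \<in> \<C> \<Longrightarrow> C \<noteq> {} \<and> closed C \<and> convex C"
    and "bounded B" and sub: "\<And>C. C \<in> \<C> \<Longrightarrow> C \<subseteq> B"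
    and directed: "\<And>C D. C \<in> \<C> \<Longrightarrow> D \<in> \<C> \<Longrightarrow> \<exists>E\<in>\<C>. E \<subseteq> C \<inter> D"
  shows "\<Inter>\<C> \<noteq> {}"
proof -
  obtain M where M: "\<And>x. x \<in> B \<Longrightarrow> norm x \<le> M"
    using \<open>bounded B\<close> bounded_iff by blast
  have abs_le: "\<bar>blinfun_apply \<phi> x\<bar> \<le> M * norm \<phi>" if "x \<in> B" for \<phi> :: "'a \<Rightarrow>\<^sub>L real" and x
  proof -
    have "norm (blinfun_apply \<phi> x) \<le> norm \<phi> * norm x" by (rule norm_blinfun)
    also have "\<dots> \<le> norm \<phi> * M" using M[OF that] by (simp add: mult_left_mono)
    finally show ?thesis by (simp add: mult.commute)
  qed
  define Q :: "('a \<Rightarrow>\<^sub>L real) \<Rightarrow> real \<Rightarrow> bool"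
    where "Q \<phi> s \<longleftrightarrow> (\<exists>C\<in>\<C>. \<forall>x\<in>C. \<phi> x \<le> s)" for \<phi> s
  have QM: "Q \<phi> (M * norm \<phi>)" for \<phi>
  proof -
    obtain C where "C \<in> \<C>" using ne by blast
    moreover have "\<phi> x \<le> M * norm \<phi>" if "x \<in> C" for x
      using abs_le[of x \<phi>] sub[OF \<open>C \<in> \<C>\<close>] that by force
    ultimately show ?thesis unfolding Q_def by blast
  qed
  have nonempty: "\<exists>s. Q \<phi> s" for \<phi> using QM by blast
  \<comment> \<open>Any point of the nonempty member \<open>C\<close> lies in \<open>B\<close>,
    where \<phi> cannot fall below this value.\<close>
  have bdd: "- (M * norm \<phi>) \<le> s" if Q: "Q \<phi> s" for \<phi> s
  proof -
    obtain C where C: "C \<in> \<C>" "\<forall>x\<in>C. \<phi> x \<le> s" using Q unfolding Q_def by blast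
    obtain x where x: "x \<in> C" using mem[OF C(1)] by blast
    then show ?thesis using abs_le[of x \<phi>] sub[OF C(1)] C(2) by fastforce
  qed
  have add: "\<exists>u\<le>s + t. Q (\<phi> + \<psi>) u" if "Q \<phi> s" "Q \<psi> t" for \<phi> \<psi> s t
  proof -
    obtain C where C: "C \<in> \<C>" "\<forall>x\<in>C. \<phi> x \<le> s" using \<open>Q \<phi> s\<close> unfolding Q_def by blast
    obtain D where D: "D \<in> \<C>" "\<forall>x\<in>D. \<psi> x \<le> t" using \<open>Q \<psi> t\<close> unfolding Q_def by blast
    \<comment> \<open>Directedness supplies one member on which both bounds hold; this is what makes
      the infimum subadditive.\<close>
    obtain E where E: "E \<in> \<C>" "E \<subseteq> C \<inter> D" using directed[OF C(1) D(1)] by blast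
    then have "\<forall>x\<in>E. (\<phi> + \<psi>) x \<le> s + t"
      using C(2) D(2) by (auto simp: blinfun.add_left intro!: add_mono)
    then have "Q (\<phi> + \<psi>) (s + t)" unfolding Q_def using E(1) by blast
    then show ?thesis by blast
  qed
  have scale: "Q (c *\<^sub>R \<phi>) (c * s)" if "Q \<phi> s" "c > 0" for \<phi> s c
    using that unfolding Q_def by (auto simp: blinfun.scaleR_left)
  have r1: "sublinear (\<lambda>x. Inf {s. Q x s})"
    by (rule sublinear_Inf_cone(1)[of Q "\<lambda>\<phi>. - (M * norm \<phi>)"]; fact nonempty bdd add scale)
  have r2: "Inf {s. Q x s} \<le> s" if "Q x s" for x s
    by (rule sublinear_Inf_cone(2)[of Q "\<lambda>\<phi>. - (M * norm \<phi>)"]; fact nonempty bdd add scale that)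
  obtain L where L: "linear L" "\<And>\<phi>. L \<phi> \<le> Inf {s. Q \<phi> s}"
    using Hahn_Banach_sublinear[OF r1] by blast
  have LQ: "L \<phi> \<le> s" if "Q \<phi> s" for \<phi> s using L(2)[of \<phi>] r2[OF that] by linarith
  have "bounded_linear L"
    by (rule linear_bounded_above_imp_bounded_linear[OF L(1), of M]) (rule LQ[OF QM])
  then have BL: "blinfun_apply (Blinfun L) = L" by (rule bounded_linear_Blinfun_apply)
  obtain x :: 'a where "bidual_embedding x = Blinfun L"
    using refl unfolding reflexive_space_def surj_def by metis
  then have Lx: "L \<phi> = \<phi> x" for \<phi>
    using BL bidual_embedding_apply[of x \<phi>] by simp
  have "x \<in> C" if "C \<in> \<C>" for C
  proof (rule ccontr)
    assume "x \<notin> C"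
    then obtain \<phi> :: "'a \<Rightarrow>\<^sub>L real" and \<delta>
      where \<phi>: "\<delta> > 0" "\<And>c. c \<in> C \<Longrightarrow> \<phi> x + \<delta> \<le> \<phi> c"
      using separating_blinfun_closed_point mem[OF \<open>C \<in> \<C>\<close>] by metis
    \<comment> \<open>Separation bounds \<open>- \<phi>\<close> on a member of the family, and
      \<open>L\<close> inherits that bound. But \<open>L\<close> is evaluation at \<open>x\<close>,
      where \<open>- \<phi>\<close> exceeds the bound by \<delta>.\<close>
    have "(- \<phi>) c \<le> - (\<phi> x + \<delta>)" if "c \<in> C" for c
      using \<phi>(2)[OF that] by (simp add: blinfun.minus_left)
    then have "Q (- \<phi>) (- (\<phi> x + \<delta>))" unfolding Q_def using that by blast
    then have "(- \<phi>) x \<le> - (\<phi> x + \<delta>)" using LQ Lx by metis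
    then show False using \<phi>(1) by (simp add: blinfun.minus_left)
  qed
  then show ?thesis by blast
qed

text \<open>The sublevel sets at attained values are nonempty and nested, hence directed. A point
  common to all of them is a minimizer.\<close>

lemma reflexive_attains_min:
  fixes K :: "'a::real_normed_vector set"
  assumes "reflexive_space TYPE('a)" "K \<noteq> {}" "bounded K"
    and closed: "\<And>c. closed {x\<in>K. f x \<le> c}" and convex: "\<And>c. convex {x\<in>K. f x \<le> c}"
  shows "\<exists>x\<in>K. \<forall>y\<in>K. f x \<le> (f y :: real)"
proof -
  let ?\<C> = "(\<lambda>y. {x\<in>K. f x \<le> f y}) ` K"
  have "\<Inter>?\<C> \<noteq> {}"
  proof (rule reflexive_directed_Inter_nonempty[OF assms(1) _ _ assms(3)])
    show "?\<C> \<noteq> {}" using assms(2) by simp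
    show "C \<noteq> {} \<and> closed C \<and> convex C" if "C \<in> ?\<C>" for C
      using that closed convex by auto
    show "C \<subseteq> K" if "C \<in> ?\<C>" for C using that by auto
    fix C D assume "C \<in> ?\<C>" "D \<in> ?\<C>"
    then obtain y z where yz: "y \<in> K" "C = {x\<in>K. f x \<le> f y}" "z \<in> K" "D = {x\<in>K. f x \<le> f z}"
      by blast
    show "\<exists>E\<in>?\<C>. E \<subseteq> C \<inter> D"
    proof (cases "f y \<le> f z")
      case True
      then have "C \<subseteq> C \<inter> D" using yz by auto
      then show ?thesis using \<open>C \<in> ?\<C>\<close> by blast
    next
      case False
      then have "D \<subseteq> C \<inter> D" using yz by auto
      then show ?thesis using \<open>D \<in> ?\<C>\<close> by blast
    qed
  qed
  then show ?thesis using assms(2) by blast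
qed

section \<open>Sublevel sets are closed and convex\<close>

lemma lower_semicontinuous_on_closed_sublevel:
  fixes K :: "'a::metric_space set"
  assumes "lower_semicontinuous_on K f" "closed K"
  shows "closed {x\<in>K. f x \<le> c}"
  unfolding closed_limpt
proof (intro allI impI)
  fix x assume x: "x islimpt {x\<in>K. f x \<le> c}"
  have "x islimpt K" using x by (rule islimpt_subset) auto
  then have xK: "x \<in> K" using assms(2) closed_limpt by blast
  have "f x \<le> c"
  proof (rule ccontr)
    assume "\<not> f x \<le> c"
    then have "\<forall>\<^sub>F y in at x within K. c < f y"
      using assms(1) xK unfolding lower_semicontinuous_on_def by auto
    then obtain d where d: "d > 0" "\<And>y. y \<in> K \<Longrightarrow> y \<noteq> x \<Longrightarrow> dist y x < d \<Longrightarrow> c < f y"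
      unfolding eventually_at by blast
    obtain y where "y \<in> {x\<in>K. f x \<le> c}" "y \<noteq> x" "dist y x < d"
      using x d(1) unfolding islimpt_approachable by blast
    then show False using d(2)[of y] by auto
  qed
  then show "x \<in> {x\<in>K. f x \<le> c}" using xK by simp
qed

lemma strongly_quasiconvex_onD:
  assumes "strongly_quasiconvex_on \<sigma> K f" "x \<in> K" "y \<in> K" "0 < t" "t < 1"
  shows "f (t *\<^sub>R x + (1 - t) *\<^sub>R y)
    \<le> max (f x) (f y) - \<sigma> / 2 * t * (1 - t) * (norm (x - y))\<^sup>2"
  using assms unfolding strongly_quasiconvex_on_def by blast

lemma strongly_quasiconvex_on_convex_sublevel:
  assumes sq: "strongly_quasiconvex_on \<sigma> K f" and "\<sigma> \<ge> 0" and "convex K"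
  shows "convex {x\<in>K. f x \<le> c}"
  unfolding convex_alt
proof (intro ballI allI impI)
  fix x y and u :: real
  assume x: "x \<in> {x\<in>K. f x \<le> c}" and y: "y \<in> {x\<in>K. f x \<le> c}" and u: "0 \<le> u \<and> u \<le> 1"
  let ?z = "(1 - u) *\<^sub>R x + u *\<^sub>R y"
  have "?z \<in> K" using x y u \<open>convex K\<close> by (auto simp: convex_alt)
  moreover have "f ?z \<le> c"
  \<comment> \<open>Strong quasiconvexity only speaks of weights strictly between 0 and 1, so the
    endpoints are treated apart.\<close>
  proof (cases "u = 0 \<or> u = 1")
    case True
    then show ?thesis using x y by auto
  next
    case False
    then have u: "0 < u" "u < 1" using u by auto
    have "f ?z \<le> max (f x) (f y) - \<sigma> / 2 * (1 - u) * u * (norm (x - y))\<^sup>2"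
      using strongly_quasiconvex_onD[OF sq, of x y "1 - u"] x y u by simp
    moreover have "0 \<le> \<sigma> / 2 * (1 - u) * u * (norm (x - y))\<^sup>2" using u \<open>\<sigma> \<ge> 0\<close> by simp
    moreover have "max (f x) (f y) \<le> c" using x y by simp
    ultimately show ?thesis by linarith
  qed
  ultimately show "?z \<in> {x\<in>K. f x \<le> c}" by simp
qed

section \<open>Existence of a minimizer on an unbounded set\<close>

lemma strongly_quasiconvex_on_sublevel_dist:
  assumes sq: "strongly_quasiconvex_on \<sigma> K f" and "\<sigma> > 0" and "convex K"
    and "x \<in> K" "y \<in> K" "f y \<le> f x"
    and lb: "\<And>z. z \<in> K \<Longrightarrow> norm (z - x) \<le> 1 \<Longrightarrow> b \<le> f z"
  shows "norm (y - x) \<le> 1 + 2 * (f x - b) / \<sigma>"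
proof (cases "norm (y - x) \<le> 1")
  case True
  have "b \<le> f x" using lb \<open>x \<in> K\<close> by simp
  then have "0 \<le> 2 * (f x - b) / \<sigma>" using \<open>\<sigma> > 0\<close> by simp
  then show ?thesis using True by linarith
next
  case False
  define d where "d = norm (y - x)"
  have d: "d > 1" using False by (simp add: d_def)
  \<comment> \<open>The weight \<open>1 / d\<close> places \<open>z\<close> on the unit sphere
    around \<open>x\<close>, where the bound \<open>b\<close> is available.\<close>
  define z where "z = (1 / d) *\<^sub>R y + (1 - 1 / d) *\<^sub>R x"
  have "z \<in> K" unfolding z_def using \<open>convex K\<close> \<open>x \<in> K\<close> \<open>y \<in> K\<close> d
    by (intro convexD) auto
  have "z - x = (1 / d) *\<^sub>R (y - x)" unfolding z_def by (simp add: algebra_simps)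
  then have "norm (z - x) = 1" using d by (simp flip: d_def)
  then have "b \<le> f z" using lb \<open>z \<in> K\<close> by simp
  also have "f z \<le> max (f y) (f x) - \<sigma> / 2 * (1 / d) * (1 - 1 / d) * (norm (y - x))\<^sup>2"
    unfolding z_def using \<open>x \<in> K\<close> \<open>y \<in> K\<close> d by (intro strongly_quasiconvex_onD[OF sq]) auto
  \<comment> \<open>The product of \<open>1 / d\<close>, \<open>1 - 1 / d\<close> and the square of
    \<open>d\<close> is \<open>d - 1\<close>: the forced decrease grows linearly with the
    distance.\<close>
  also have "\<dots> = f x - \<sigma> / 2 * (d - 1)"
    using d \<open>f y \<le> f x\<close> by (simp add: d_def[symmetric] max_def field_simps power2_eq_square)
  finally have "\<sigma> * (d - 1) \<le> 2 * (f x - b)" by simp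
  then have "d - 1 \<le> 2 * (f x - b) / \<sigma>" using \<open>\<sigma> > 0\<close> by (simp add: field_simps)
  then show ?thesis by (simp add: d_def)
qed

lemma strongly_quasiconvex_on_attains_min:
  fixes K :: "'a::real_normed_vector set"
  assumes refl: "reflexive_space TYPE('a)" and "K \<noteq> {}" "closed K" "convex K"
    and lsc: "lower_semicontinuous_on K f"
    and sq: "strongly_quasiconvex_on \<sigma> K f" and "\<sigma> > 0"
  shows "\<exists>x\<in>K. \<forall>y\<in>K. f x \<le> f y"
proof -
  obtain x0 where x0: "x0 \<in> K" using \<open>K \<noteq> {}\<close> by blast
  have min_ball: "\<exists>x\<in>K \<inter> cball x0 r. \<forall>y\<in>K \<inter> cball x0 r. f x \<le> f y" if "r \<ge> 0" for r
  proof (rule reflexive_attains_min[OF refl])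
    show "K \<inter> cball x0 r \<noteq> {}" using x0 that by auto
    show "bounded (K \<inter> cball x0 r)" by (simp add: bounded_Int)
    fix c
    have eq: "{x \<in> K \<inter> cball x0 r. f x \<le> c} = {x\<in>K. f x \<le> c} \<inter> cball x0 r" by auto
    show "closed {x \<in> K \<inter> cball x0 r. f x \<le> c}"
      unfolding eq using lower_semicontinuous_on_closed_sublevel[OF lsc \<open>closed K\<close>]
      by (intro closed_Int) auto
    show "convex {x \<in> K \<inter> cball x0 r. f x \<le> c}"
      unfolding eq using strongly_quasiconvex_on_convex_sublevel[OF sq _ \<open>convex K\<close>] \<open>\<sigma> > 0\<close>
      by (intro convex_Int) auto
  qed
  \<comment> \<open>A first minimization, on the unit ball, only provides the lower bound
    \<open>f x1\<close> that bounds the sublevel set of \<open>x0\<close>.\<close>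
  obtain x1 where x1: "x1 \<in> K" "\<And>y. y \<in> K \<Longrightarrow> norm (y - x0) \<le> 1 \<Longrightarrow> f x1 \<le> f y"
    using min_ball[of 1] by (auto simp: dist_norm norm_minus_commute)
  define r where "r = 1 + 2 * (f x0 - f x1) / \<sigma>"
  have "f x1 \<le> f x0" using x1(2)[OF x0] by simp
  then have "0 \<le> 2 * (f x0 - f x1) / \<sigma>" using \<open>\<sigma> > 0\<close> by simp
  then have r: "r \<ge> 0" unfolding r_def by linarith
  \<comment> \<open>The ball of radius \<open>r\<close> contains that whole sublevel set. Points of
    \<open>K\<close> outside it have values above \<open>f x0\<close>, and \<open>x0\<close> itself
    competes in the ball, so \<open>x2\<close> is a global minimizer.\<close>
  obtain x2 where x2: "x2 \<in> K" "\<And>y. y \<in> K \<Longrightarrow> norm (y - x0) \<le> r \<Longrightarrow> f x2 \<le> f y"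
    using min_ball[OF r] by (auto simp: dist_norm norm_minus_commute)
  have "f x2 \<le> f y" if y: "y \<in> K" for y
  proof (cases "f y \<le> f x0")
    case True
    then have "norm (y - x0) \<le> r" unfolding r_def
      using strongly_quasiconvex_on_sublevel_dist[OF sq \<open>\<sigma> > 0\<close> \<open>convex K\<close> x0 y] x1(2) by blast
    then show ?thesis using x2(2) y by blast
  next
    case False
    then show ?thesis using x2(2)[OF x0] r by simp
  qed
  then show ?thesis using x2(1) by blast
qed

section \<open>Quadratic growth around the minimizer\<close>

lemma strongly_quasiconvex_on_growth_step:
  assumes sq: "strongly_quasiconvex_on \<sigma> K f" and "convex K" "x \<in> K"
    and growth: "\<And>y. y \<in> K \<Longrightarrow> f x + c * (norm (y - x))\<^sup>2 \<le> f y" and "c \<ge> 0"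
    and "y \<in> K" "0 < t" "t < 1"
  shows "f x + (c * (1 - t)\<^sup>2 + \<sigma> / 2 * t * (1 - t)) * (norm (y - x))\<^sup>2 \<le> f y"
proof -
  \<comment> \<open>The value at \<open>z\<close> is squeezed: growth with constant \<open>c\<close>
    bounds it from below, strong quasiconvexity from above by \<open>f y\<close> minus the modulus
    term. Comparing the two gives the new constant.\<close>
  define z where "z = t *\<^sub>R x + (1 - t) *\<^sub>R y"
  have "z \<in> K" unfolding z_def using assms by (intro convexD) auto
  have "z - x = (1 - t) *\<^sub>R (y - x)" unfolding z_def by (simp add: algebra_simps)
  then have "norm (z - x) = (1 - t) * norm (y - x)" using \<open>t < 1\<close> by simp
  then have "f x + c * ((1 - t)\<^sup>2 * (norm (y - x))\<^sup>2) \<le> f z"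
    using growth[OF \<open>z \<in> K\<close>] by (simp add: power_mult_distrib)
  moreover have "f z \<le> max (f x) (f y) - \<sigma> / 2 * t * (1 - t) * (norm (x - y))\<^sup>2"
    unfolding z_def using assms by (intro strongly_quasiconvex_onD[OF sq]) auto
  moreover have "0 \<le> c * (norm (y - x))\<^sup>2" using \<open>c \<ge> 0\<close> by simp
  then have "f x \<le> f y" using growth[OF \<open>y \<in> K\<close>] by linarith
  ultimately show ?thesis
    by (simp add: norm_minus_commute max_def algebra_simps)
qed

lemma strongly_quasiconvex_on_quadratic_growth:
  assumes sq: "strongly_quasiconvex_on \<sigma> K f" and "\<sigma> > 0" and "convex K" "x \<in> K"
    and min: "\<And>y. y \<in> K \<Longrightarrow> f x \<le> f y" and y: "y \<in> K"
  shows "f x + \<sigma> / 4 * (norm (y - x))\<^sup>2 \<le> f y"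
proof (cases "y = x")
  case True
  then show ?thesis by simp
next
  case False
  \<comment> \<open>The admissible growth constants; the given point \<open>y\<close>, distinct from
    \<open>x\<close>, bounds them from above.\<close>
  define S where "S = {c. c \<ge> 0 \<and> (\<forall>y\<in>K. f x + c * (norm (y - x))\<^sup>2 \<le> f y)}"
  have S0: "0 \<in> S" using min by (simp add: S_def)
  have bdd: "bdd_above S"
  proof (rule bdd_aboveI)
    fix c assume "c \<in> S"
    then have "c * (norm (y - x))\<^sup>2 \<le> f y - f x" using y by (auto simp: S_def)
    then show "c \<le> (f y - f x) / (norm (y - x))\<^sup>2" using False by (simp add: field_simps)
  qed
  define s where "s = Sup S"
  have s0: "s \<ge> 0" unfolding s_def using S0 bdd by (rule cSup_upper)
  \<comment> \<open>The supremum is itself admissible, so the growth step can start from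
    \<open>c = s\<close>.\<close>
  have s: "f x + s * (norm (z - x))\<^sup>2 \<le> f z" if "z \<in> K" for z
  proof (cases "z = x")
    case True
    then show ?thesis by simp
  next
    case False
    have "s \<le> (f z - f x) / (norm (z - x))\<^sup>2"
      unfolding s_def
    proof (rule cSup_least)
      show "S \<noteq> {}" using S0 by blast
      fix c assume "c \<in> S"
      then have "c * (norm (z - x))\<^sup>2 \<le> f z - f x" using that by (auto simp: S_def)
      then show "c \<le> (f z - f x) / (norm (z - x))\<^sup>2" using False by (simp add: field_simps)
    qed
    then show ?thesis using False by (simp add: field_simps)
  qed
  \<comment> \<open>The improved constant is admissible again, hence at most \<open>s\<close>;
    cancelling a factor \<open>t\<close> leaves this inequality.\<close>
  have step: "\<sigma> / 2 * (1 - t) \<le> s * (2 - t)" if t: "0 < t" "t < 1" for t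
  proof -
    have "s * (1 - t)\<^sup>2 + \<sigma> / 2 * t * (1 - t) \<in> S"
      unfolding S_def
      using strongly_quasiconvex_on_growth_step[OF sq \<open>convex K\<close> \<open>x \<in> K\<close> s s0 _ t] s0 t \<open>\<sigma> > 0\<close>
      by simp
    then have "s * (1 - t)\<^sup>2 + \<sigma> / 2 * t * (1 - t) \<le> s"
      unfolding s_def using bdd by (rule cSup_upper)
    then have "t * (\<sigma> / 2 * (1 - t)) \<le> t * (s * (2 - t))"
      by (simp add: power2_eq_square algebra_simps)
    then show ?thesis using t(1) by (rule mult_left_le_imp_le)
  qed
  have "\<sigma> / 4 \<le> s"
  proof (rule ccontr)
    assume "\<not> \<sigma> / 4 \<le> s"
    \<comment> \<open>A concrete \<open>t\<close> replaces the limit \<open>t\<close> to 0. It is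
      chosen so that \<open>\<sigma> * t\<close> equals the gap \<open>\<sigma> / 2 - 2 * s\<close>;
      the step then gives \<open>\<sigma> * t \<le> \<sigma> * t / 2 - s * t\<close>, impossible for
      positive \<open>\<sigma> * t\<close>.\<close>
    define t where "t = 1 / 2 - 2 * s / \<sigma>"
    have t: "0 < t" "t < 1" using \<open>\<not> \<sigma> / 4 \<le> s\<close> s0 \<open>\<sigma> > 0\<close> by (auto simp: t_def field_simps)
    have "\<sigma> * t = \<sigma> / 2 - 2 * s" using \<open>\<sigma> > 0\<close> by (simp add: t_def field_simps)
    moreover have "\<sigma> / 2 - 2 * s \<le> \<sigma> * t / 2 - s * t"
      using step[OF t] by (simp add: right_diff_distrib)
    moreover have "0 \<le> s * t" "0 < \<sigma> * t" using s0 t \<open>\<sigma> > 0\<close> by simp_all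
    ultimately show False by linarith
  qed
  then have "\<sigma> / 4 * (norm (y - x))\<^sup>2 \<le> s * (norm (y - x))\<^sup>2" by (intro mult_right_mono) auto
  then show ?thesis using s[OF y] by linarith
qed

theorem theorem5p1:
  fixes \<sigma> :: real
    and K :: "'a::banach set"
    and f :: "'a \<Rightarrow> real"
  assumes "\<sigma> > 0"
    and "\<exists>x::'a. x \<noteq> 0"
    and "reflexive_space TYPE('a)"
    and "K \<noteq> {}" and "closed K" and "convex K"
    and "lower_semicontinuous_on K f"
    and "strongly_quasiconvex_on \<sigma> K f"
  shows "\<exists>xbar\<in>K. argmin_on K f = {xbar} \<and>
    (\<forall>y\<in>K. f xbar + \<sigma> / 4 * (norm (y - xbar))\<^sup>2 \<le> f y)"
proof -
  obtain x where x: "x \<in> K" "\<And>y. y \<in> K \<Longrightarrow> f x \<le> f y"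
    using strongly_quasiconvex_on_attains_min assms by metis
  have growth: "f x + \<sigma> / 4 * (norm (y - x))\<^sup>2 \<le> f y" if "y \<in> K" for y
    using strongly_quasiconvex_on_quadratic_growth[OF assms(8,1,6) x that] .
  \<comment> \<open>Uniqueness follows from the growth estimate: a second minimizer would be at
    distance 0 from \<open>x\<close>.\<close>
  have "y = x" if "y \<in> K" "f y \<le> f x" for y
  proof -
    have "\<sigma> / 4 * (norm (y - x))\<^sup>2 \<le> 0" using growth[OF that(1)] that(2) by linarith
    then show ?thesis using \<open>\<sigma> > 0\<close> by (simp add: mult_le_0_iff)
  qed
  then have "argmin_on K f = {x}"
    using x unfolding argmin_on_def is_arg_min_linorder by auto
  then show ?thesis using x(1) growth by blast
qed

end
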